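(* Let $\mathcal F$ be a function space on a finite partially ordered set $\mathfrak T$, and assume that we have a consistent family of extension operators $E_G^F\colon\mathring{\mathcal F}(G)\to\mathcal F(F)$. Then we can extend $E_G^F$ to a linear map on the full space $\mathcal F(G)$, still denoted $E_G^F\colon\mathcal F(G)\to\mathcal F(F)$, by defining $$E_G^F(E_K^G\psi):=E_K^F\psi\qquad\text{for every }K\le G\text{ and }\psi\in\mathring{\mathcal F}(K).$$ These extension operators satisfy the properties that (1) $\operatorname{tr}^F_GE^F_G\colon\mathcal F(G)\to\mathcal F(G)$ is the identity whenever $G\le F$; (2) $\operatorname{tr}_G^TE_F^T=E^G_K\operatorname{tr}_K^F\colon\mathcal F(F)\to\mathcal F(G)$ whenever $K\le F,G\le T$ (that is, whenever $K\le F$, $K\le G$, $F\le T$ and $G\le T$).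
   Context: A function space $\mathcal F$ on a partially ordered set $\mathfrak T$ consists of a vector space $\mathcal F(F)$ for every $F\in\mathfrak T$ and a linear map $\operatorname{tr}^F_K\colon\mathcal F(F)\to\mathcal F(K)$ (trace map) for every relation $K\le F$, such that $\operatorname{tr}^F_F$ is the identity and $\operatorname{tr}^G_K\circ\operatorname{tr}^F_G=\operatorname{tr}^F_K$ whenever $K\le G\le F$. The subspace of vanishing trace is $\mathring{\mathcal F}(F)=\{\phi\in\mathcal F(F)\mid\operatorname{tr}^F_K\phi=0\text{ for all }K<F\}$. A consistent family of extension operators on $\mathfrak T$ is a family of linear maps $E^F_K\colon\mathring{\mathcal F}(K)\to\mathcal F(F)$, one for every $K,F\in\mathfrak T$, such that (i) $E^K_K\colon\mathring{\mathcal F}(K)\to\mathcal F(K)$ is the inclusion; (ii) $E^F_K=0$ if $K\not\le F$; (iii) $\operatorname{tr}^F_GE^F_K=E^G_K$ whenever $G\le F$.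
   Formalization: Property (2) is stated only when K is the greatest lower bound of F and G in the poset; for an arbitrary K ≤ F, G ≤ T it is false (K < F = G = T with zero space at K and a one-dimensional space at F gives the identity on the left, zero on the right). *)

theory Defs
  imports Complex_Main
begin

definition linear_map_on ::
    "('k::field \<Rightarrow> 'v::ab_group_add \<Rightarrow> 'v) \<Rightarrow> 'v set \<Rightarrow> 'v set \<Rightarrow> ('v \<Rightarrow> 'v) \<Rightarrow> bool" where
  "linear_map_on scale U W f \<longleftrightarrow>
     (\<forall>x\<in>U. f x \<in> W) \<and>
     (\<forall>x\<in>U. \<forall>y\<in>U. f (x + y) = f x + f y) \<and>
     (\<forall>c. \<forall>x\<in>U. f (scale c x) = scale c (f x))"

text \<open>
  The poset is a set \<open>P\<close> in an ordered type. The vector spaces \<open>V F\<close> are subspaces of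
  one ambient vector space, which is no restriction: any family of vector spaces embeds in its
  direct sum. No relation between the subspaces is assumed. \<open>tr F K\<close> stands for
  \<open>tr\<^sup>F\<^sub>K\<close>; it is a total function of which only the restriction to \<open>V F\<close> matters.
\<close>

locale function_space = vector_space scale
  for scale :: "'k::field \<Rightarrow> 'v::ab_group_add \<Rightarrow> 'v" +
  fixes P :: "'p::order set"
    and V :: "'p \<Rightarrow> 'v set"
    and tr :: "'p \<Rightarrow> 'p \<Rightarrow> 'v \<Rightarrow> 'v"
  assumes subspace_V: "F \<in> P \<Longrightarrow> subspace (V F)"
    and linear_tr: "\<lbrakk>K \<in> P; F \<in> P; K \<le> F\<rbrakk> \<Longrightarrow> linear_map_on scale (V F) (V K) (tr F K)"
    and tr_id: "\<lbrakk>F \<in> P; \<phi> \<in> V F\<rbrakk> \<Longrightarrow> tr F F \<phi> = \<phi>"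
    and tr_comp: "\<lbrakk>K \<in> P; G \<in> P; F \<in> P; K \<le> G; G \<le> F; \<phi> \<in> V F\<rbrakk>
      \<Longrightarrow> tr G K (tr F G \<phi>) = tr F K \<phi>"

definition vanishing_trace ::
    "'p::order set \<Rightarrow> ('p \<Rightarrow> 'v::zero set) \<Rightarrow> ('p \<Rightarrow> 'p \<Rightarrow> 'v \<Rightarrow> 'v) \<Rightarrow> 'p \<Rightarrow> 'v set" where
  "vanishing_trace P V tr F = {\<phi> \<in> V F. \<forall>K\<in>P. K < F \<longrightarrow> tr F K \<phi> = 0}"

text \<open>
  \<open>E F K\<close> stands for \<open>E\<^sup>F\<^sub>K\<close>; only its restriction to \<open>vanishing_trace P V tr K\<close> matters.
\<close>

locale consistent_extension_operators = function_space scale P V tr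
  for scale :: "'k::field \<Rightarrow> 'v::ab_group_add \<Rightarrow> 'v"
    and P :: "'p::order set"
    and V :: "'p \<Rightarrow> 'v set"
    and tr :: "'p \<Rightarrow> 'p \<Rightarrow> 'v \<Rightarrow> 'v" +
  fixes E :: "'p \<Rightarrow> 'p \<Rightarrow> 'v \<Rightarrow> 'v"
  assumes linear_E: "\<lbrakk>K \<in> P; F \<in> P\<rbrakk>
      \<Longrightarrow> linear_map_on scale (vanishing_trace P V tr K) (V F) (E F K)"
    and E_incl: "\<lbrakk>K \<in> P; \<psi> \<in> vanishing_trace P V tr K\<rbrakk> \<Longrightarrow> E K K \<psi> = \<psi>"
    and E_zero: "\<lbrakk>K \<in> P; F \<in> P; \<not> K \<le> F; \<psi> \<in> vanishing_trace P V tr K\<rbrakk> \<Longrightarrow> E F K \<psi> = 0"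
    and tr_E: "\<lbrakk>K \<in> P; G \<in> P; F \<in> P; G \<le> F; \<psi> \<in> vanishing_trace P V tr K\<rbrakk>
      \<Longrightarrow> tr F G (E F K \<psi>) = E G K \<psi>"

text \<open>
  \<open>X\<close> is a family of linear maps \<open>X F G\<close> from \<open>V G\<close> to \<open>V F\<close>, for all \<open>F\<close> and \<open>G\<close> in \<open>P\<close>
  (comparable or not), that satisfies the defining equation of the extended operators.
\<close>

definition full_extension ::
    "('k::field \<Rightarrow> 'v::ab_group_add \<Rightarrow> 'v) \<Rightarrow> 'p::order set \<Rightarrow> ('p \<Rightarrow> 'v set) \<Rightarrow>
     ('p \<Rightarrow> 'p \<Rightarrow> 'v \<Rightarrow> 'v) \<Rightarrow> ('p \<Rightarrow> 'p \<Rightarrow> 'v \<Rightarrow> 'v) \<Rightarrow> ('p \<Rightarrow> 'p \<Rightarrow> 'v \<Rightarrow> 'v) \<Rightarrow> bool" where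
  "full_extension scale P V tr E X \<longleftrightarrow>
     (\<forall>F\<in>P. \<forall>G\<in>P. linear_map_on scale (V G) (V F) (X F G) \<and>
        (\<forall>K\<in>P. K \<le> G \<longrightarrow> (\<forall>\<psi>\<in>vanishing_trace P V tr K. X F G (E G K \<psi>) = E F K \<psi>)))"

text \<open>
  The identity \<open>tr\<^sup>T\<^sub>G E\<^sup>T\<^sub>F = E\<^sup>G\<^sub>K tr\<^sup>F\<^sub>K\<close> fails if \<open>K\<close> is merely a common lower bound of \<open>F\<close> and
  \<open>G\<close>: for \<open>K < F = G = T\<close> with zero space at \<open>K\<close> and one-dimensional space at \<open>F\<close>, the left
  side is the identity and the right side is zero. It holds when \<open>K\<close> is their greatest common
  lower bound, as is \<open>F \<inter> G\<close> for the faces of a triangulation.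
\<close>

definition is_meet :: "'p::order set \<Rightarrow> 'p \<Rightarrow> 'p \<Rightarrow> 'p \<Rightarrow> bool" where
  "is_meet P F G K \<longleftrightarrow>
     K \<in> P \<and> K \<le> F \<and> K \<le> G \<and> (\<forall>L\<in>P. L \<le> F \<longrightarrow> L \<le> G \<longrightarrow> L \<le> K)"

end

theory Submission
  imports Defs
begin

text \<open>
  A consistent family of extension operators splits every space into copies of the spaces of
  vanishing trace: each \<open>\<phi> \<in> V G\<close> is \<open>\<Sum>K \<le> G. E G K \<psi>\<^sub>K\<close> for exactly one choice of
  \<open>\<psi>\<^sub>K\<close> with vanishing trace on \<open>K\<close>. Once this is known, the defining equation forces the extended
  operator to send \<open>\<phi>\<close> to \<open>\<Sum>K \<le> G. E F K \<psi>\<^sub>K\<close>, which settles existence and uniqueness.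

  The components are found from the bottom of the poset upwards. The component of \<open>\<phi>\<close> at \<open>K\<close>
  depends only on \<open>tr G K \<phi>\<close>, so it suffices to have one map \<open>bubble K\<close> on \<open>V K\<close>, the component at
  the top. It subtracts from \<open>\<chi>\<close> the extensions of the components of all proper traces of \<open>\<chi>\<close>.
  The remainder has vanishing trace (\<open>bubble_vanishing\<close>): by consistency, the trace on \<open>L\<close> of the
  subtracted sum is the sum that decomposes \<open>tr K L \<chi>\<close>. Uniqueness of the components is the
  biorthogonality \<open>bubble_E\<close>: the component at \<open>K\<close> of \<open>E K L \<psi>\<close> is \<open>\<psi>\<close> for \<open>L = K\<close> and zero
  otherwise.

  By consistency, \<open>tr T G\<close> turns the expansion of \<open>X T F \<phi>\<close> into
  \<open>\<Sum>L \<le> F. E G L \<psi>\<^sub>L\<close>. For \<open>F = G\<close> this is \<open>\<phi>\<close> itself, which gives the first property. In general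
  the terms with \<open>L\<close> not below \<open>G\<close> vanish; when \<open>K\<close> is the meet of \<open>F\<close> and \<open>G\<close>, those that
  remain are the ones with \<open>L \<le> K\<close>, and they are the expansion of \<open>X G K (tr F K \<phi>)\<close>.
\<close>

section \<open>Linear maps on subspaces\<close>

lemma linear_map_onD:
  assumes "linear_map_on scale U W f"
  shows "x \<in> U \<Longrightarrow> f x \<in> W"
    and "x \<in> U \<Longrightarrow> y \<in> U \<Longrightarrow> f (x + y) = f x + f y"
    and "x \<in> U \<Longrightarrow> f (scale c x) = scale c (f x)"
  using assms unfolding linear_map_on_def by auto

lemma linear_map_on_comp:
  assumes "linear_map_on scale U W f" "linear_map_on scale W Z g"
  shows "linear_map_on scale U Z (\<lambda>x. g (f x))"
  using assms unfolding linear_map_on_def by auto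

context vector_space
begin

lemma linear_map_on_0:
  assumes "subspace U" "linear_map_on scale U W f"
  shows "f 0 = 0"
  using linear_map_onD(2)[OF assms(2), of 0 0] subspace_0[OF assms(1)] by simp

lemma linear_map_on_diff:
  assumes U: "subspace U" and f: "linear_map_on scale U W f" and "x \<in> U" "y \<in> U"
  shows "f (x - y) = f x - f y"
  using linear_map_onD(2)[OF f, of "x - y" y] subspace_diff[OF U] assms(3,4) by simp

lemma linear_map_on_sum:
  assumes U: "subspace U" and f: "linear_map_on scale U W f" and x: "\<And>i. i \<in> A \<Longrightarrow> x i \<in> U"
  shows "f (\<Sum>i\<in>A. x i) = (\<Sum>i\<in>A. f (x i))"
  using x
proof (induction A rule: infinite_finite_induct)
  case (insert i A)
  then show ?case
    using linear_map_onD(2)[OF f, of "x i" "\<Sum>i\<in>A. x i"] subspace_sum[OF U, of A x] by simp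
qed (simp_all add: linear_map_on_0[OF U f])

lemma linear_map_on_diff_maps:
  assumes "subspace W" "linear_map_on scale U W f" "linear_map_on scale U W g"
  shows "linear_map_on scale U W (\<lambda>x. f x - g x)"
  using assms unfolding linear_map_on_def
  by (auto simp: scale_right_diff_distrib subspace_diff)

lemma linear_map_on_sum_maps:
  assumes "subspace W" "\<And>i. i \<in> A \<Longrightarrow> linear_map_on scale U W (f i)"
  shows "linear_map_on scale U W (\<lambda>x. \<Sum>i\<in>A. f i x)"
  using assms unfolding linear_map_on_def
  by (auto simp: scale_sum_right sum.distrib intro: subspace_sum)

lemma linear_map_on_id:
  "linear_map_on scale U U (\<lambda>x. x)"
  by (simp add: linear_map_on_def)

end

section \<open>Decomposition into components of vanishing trace\<close>

lemma (in function_space) subspace_vanishing_trace: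
  assumes F: "F \<in> P"
  shows "subspace (vanishing_trace P V tr F)"
proof -
  have V: "subspace (V F)"
    using F by (rule subspace_V)
  have t: "linear_map_on scale (V F) (V K) (tr F K)" if "K \<in> P" "K < F" for K
    using linear_tr F that by simp
  show ?thesis
    unfolding subspace_def vanishing_trace_def
    by (auto simp: subspace_0[OF V] subspace_add[OF V] subspace_scale[OF V]
        linear_map_on_0[OF V t] linear_map_onD(2)[OF t] linear_map_onD(3)[OF t])
qed

locale finite_consistent_extension_operators =
  consistent_extension_operators scale P V tr E
  for scale :: "'k::field \<Rightarrow> 'v::ab_group_add \<Rightarrow> 'v"
    and P :: "'p::order set"
    and V :: "'p \<Rightarrow> 'v set"
    and tr E :: "'p \<Rightarrow> 'p \<Rightarrow> 'v \<Rightarrow> 'v" +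
  assumes finite_P: "finite P"
begin

abbreviation V0 :: "'p \<Rightarrow> 'v set" where
  "V0 \<equiv> vanishing_trace P V tr"

lemma card_below_less:
  assumes "L \<in> P" "L < K"
  shows "card {M\<in>P. M < L} < card {M\<in>P. M < K}"
proof (rule psubset_card_mono)
  show "{M\<in>P. M < L} \<subset> {M\<in>P. M < K}"
    using assms by auto
qed (simp add: finite_P)

lemma poset_induct [consumes 1, case_names less]:
  assumes "K \<in> P" and "\<And>K. K \<in> P \<Longrightarrow> (\<And>L. L \<in> P \<Longrightarrow> L < K \<Longrightarrow> Q L) \<Longrightarrow> Q K"
  shows "Q K"
  using assms(1)
proof (induction "card {L\<in>P. L < K}" arbitrary: K rule: less_induct)
  case less
  then show ?case
    using assms(2) card_below_less by blast
qed

text \<open>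
  The part of \<open>\<chi> \<in> V K\<close> that is not accounted for by its traces on smaller elements, in analogy
  with the bubble functions of a finite element.
\<close>

function bubble :: "'p \<Rightarrow> 'v \<Rightarrow> 'v" where
  "bubble K \<chi> = \<chi> - (\<Sum>L\<in>{L\<in>P. L < K}. E K L (bubble L (tr K L \<chi>)))"
  by auto
termination
proof (relation "measure (\<lambda>(K, \<chi>). card {L\<in>P. L < K})")
  fix K :: 'p and \<chi> :: 'v and L
  assume "L \<in> {L\<in>P. L < K}"
  then show "((L, tr K L \<chi>), (K, \<chi>)) \<in> measure (\<lambda>(K, \<chi>). card {L\<in>P. L < K})"
    by (simp add: card_below_less)
qed simp

declare bubble.simps [simp del]

lemma below_split: "K \<in> P \<Longrightarrow> {L\<in>P. L \<le> K} = insert K {L\<in>P. L < K}"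
  by auto

text \<open>
  This is the definition of \<open>bubble\<close> solved for \<open>\<chi>\<close>, with \<open>bubble K \<chi>\<close> written as the term of
  the sum at \<open>K\<close>. This needs \<open>E K K (bubble K \<chi>) = bubble K \<chi>\<close>, and \<open>E K K\<close> is the inclusion
  on \<open>V0 K\<close> only; hence the hypothesis. The inductive proof that the hypothesis always holds
  uses the decomposition at smaller elements.
\<close>

lemma decomposition_if_bubble:
  assumes K: "K \<in> P" and "\<chi> \<in> V K" and "bubble K \<chi> \<in> V0 K"
  shows "(\<Sum>L\<in>{L\<in>P. L \<le> K}. E K L (bubble L (tr K L \<chi>))) = \<chi>"
  using assms
  by (simp add: below_split finite_P tr_id E_incl bubble.simps[of K \<chi>])

lemma bubble_vanishing:
  assumes "K \<in> P" "\<chi> \<in> V K"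
  shows "bubble K \<chi> \<in> V0 K"
  using assms
proof (induction K arbitrary: \<chi> rule: poset_induct)
  case (less K)
  define S where "S = {L\<in>P. L < K}"
  have V: "subspace (V K)"
    using less.hyps by (rule subspace_V)
  have t: "linear_map_on scale (V K) (V L) (tr K L)" "tr K L \<chi> \<in> V L" if "L \<in> P" "L \<le> K" for L
    using linear_tr[OF that(1) less.hyps that(2)] linear_map_onD(1) less.prems by blast+
  have b: "bubble L (tr K L \<chi>) \<in> V0 L" if "L \<in> S" for L
    using that t(2) by (intro less.IH) (auto simp: S_def)
  have e: "E K L (bubble L (tr K L \<chi>)) \<in> V K" if "L \<in> S" for L
    using that linear_map_onD(1)[OF linear_E b[OF that]] less.hyps by (auto simp: S_def)
  have "tr K M (bubble K \<chi>) = 0" if M: "M \<in> P" "M < K" for M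
  proof -
    have MK: "M \<le> K"
      using M by simp
    have "tr K M (bubble K \<chi>) = tr K M \<chi> - (\<Sum>L\<in>S. tr K M (E K L (bubble L (tr K L \<chi>))))"
      using e less.prems t(1)[OF M(1) MK] unfolding bubble.simps[of K] S_def[symmetric]
      by (simp add: linear_map_on_diff[OF V] linear_map_on_sum[OF V] subspace_sum[OF V])
    also have "(\<Sum>L\<in>S. tr K M (E K L (bubble L (tr K L \<chi>))))
        = (\<Sum>L\<in>S. E M L (bubble L (tr K L \<chi>)))"
      using b M MK less.hyps by (intro sum.cong refl tr_E) (auto simp: S_def)
    also have "\<dots> = (\<Sum>L\<in>{L\<in>P. L \<le> M}. E M L (bubble L (tr K L \<chi>)))"
      using b M finite_P by (intro sum.mono_neutral_right) (auto simp: S_def intro!: E_zero)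
    also have "\<dots> = (\<Sum>L\<in>{L\<in>P. L \<le> M}. E M L (bubble L (tr M L (tr K M \<chi>))))"
      using M MK less by (intro sum.cong refl) (simp add: tr_comp)
    also have "\<dots> = tr K M \<chi>"
      using M MK t(2) less.IH by (intro decomposition_if_bubble) auto
    finally show ?thesis
      by simp
  qed
  moreover have "bubble K \<chi> \<in> V K"
    using less.prems e unfolding bubble.simps[of K] S_def[symmetric]
    by (intro subspace_diff[OF V] subspace_sum[OF V]) auto
  ultimately show ?case
    by (simp add: vanishing_trace_def)
qed

lemma linear_bubble:
  assumes "K \<in> P"
  shows "linear_map_on scale (V K) (V0 K) (bubble K)"
  using assms
proof (induction K rule: poset_induct)
  case (less K)
  have "linear_map_on scale (V K) (V K) (\<lambda>\<chi>. E K L (bubble L (tr K L \<chi>)))"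
    if "L \<in> {L\<in>P. L < K}" for L
    using that less
    by (intro linear_map_on_comp[OF linear_map_on_comp[OF linear_tr less.IH] linear_E]) auto
  then have "linear_map_on scale (V K) (V K)
      (\<lambda>\<chi>. \<chi> - (\<Sum>L\<in>{L\<in>P. L < K}. E K L (bubble L (tr K L \<chi>))))"
    using less.hyps subspace_V
    by (intro linear_map_on_diff_maps linear_map_on_sum_maps linear_map_on_id) auto
  then show ?case
    using bubble_vanishing[OF less.hyps]
    unfolding linear_map_on_def bubble.simps[of K, symmetric] by blast
qed

lemma bubble_tr:
  assumes "G \<in> P" "K \<in> P" "K \<le> G" "\<phi> \<in> V G"
  shows "bubble K (tr G K \<phi>) \<in> V0 K"
  using assms linear_map_onD(1)[OF linear_tr] by (intro bubble_vanishing) auto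

lemma decomposition:
  assumes "G \<in> P" "\<phi> \<in> V G"
  shows "(\<Sum>K\<in>{K\<in>P. K \<le> G}. E G K (bubble K (tr G K \<phi>))) = \<phi>"
  using assms by (intro decomposition_if_bubble bubble_vanishing)

text \<open>
  By consistency the traces of \<open>E K L \<psi>\<close> are again of the form \<open>E M L \<psi>\<close>. So by induction the
  sum subtracted in \<open>bubble K (E K L \<psi>)\<close> can have a nonzero term at \<open>M = L\<close> only. That term occurs
  if \<open>L < K\<close>, and it is all of \<open>E K L \<psi>\<close>, so that nothing remains.
\<close>

lemma bubble_E:
  assumes "K \<in> P" "L \<in> P" "\<psi> \<in> V0 L"
  shows "bubble K (E K L \<psi>) = (if L = K then \<psi> else 0)"
  using assms(1)
proof (induction K rule: poset_induct)
  case (less K)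
  have E0: "E K M 0 = 0" if "M \<in> P" for M
    using linear_map_on_0[OF subspace_vanishing_trace linear_E] less.hyps that by blast
  have "(\<Sum>M\<in>{M\<in>P. M < K}. E K M (bubble M (tr K M (E K L \<psi>))))
      = (\<Sum>M\<in>{M\<in>P. M < K}. if L = M then E K L \<psi> else 0)"
  proof (rule sum.cong)
    fix M assume "M \<in> {M\<in>P. M < K}"
    then show "E K M (bubble M (tr K M (E K L \<psi>))) = (if L = M then E K L \<psi> else 0)"
      using less assms by (auto simp: tr_E E0)
  qed simp
  also have "\<dots> = (if L < K then E K L \<psi> else 0)"
    using assms finite_P by simp
  finally show ?case
    using less.hyps assms by (auto simp: bubble.simps[of K] E_incl E_zero order.strict_iff_order)
qed

section \<open>The extended operators\<close>

definition full_E :: "'p \<Rightarrow> 'p \<Rightarrow> 'v \<Rightarrow> 'v" where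
  "full_E F G \<phi> = (\<Sum>K\<in>{K\<in>P. K \<le> G}. E F K (bubble K (tr G K \<phi>)))"

lemma linear_full_E:
  assumes "F \<in> P" "G \<in> P"
  shows "linear_map_on scale (V G) (V F) (full_E F G)"
proof -
  have "linear_map_on scale (V G) (V F) (\<lambda>\<phi>. E F K (bubble K (tr G K \<phi>)))"
    if "K \<in> {K\<in>P. K \<le> G}" for K
    using that assms
    by (intro linear_map_on_comp[OF linear_map_on_comp[OF linear_tr linear_bubble] linear_E]) auto
  then show ?thesis
    unfolding full_E_def[abs_def] using assms subspace_V by (intro linear_map_on_sum_maps) auto
qed

lemma full_E_E:
  assumes "F \<in> P" "G \<in> P" "K \<in> P" "K \<le> G" "\<psi> \<in> V0 K"
  shows "full_E F G (E G K \<psi>) = E F K \<psi>"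
proof -
  have "E F L 0 = 0" if "L \<in> P" for L
    using linear_map_on_0[OF subspace_vanishing_trace linear_E] assms that by blast
  then have "full_E F G (E G K \<psi>) = (\<Sum>L\<in>{L\<in>P. L \<le> G}. if K = L then E F K \<psi> else 0)"
    unfolding full_E_def using assms by (intro sum.cong) (auto simp: tr_E bubble_E)
  then show ?thesis
    using assms finite_P by simp
qed

lemma full_extension_full_E: "full_extension scale P V tr E full_E"
  unfolding full_extension_def using linear_full_E full_E_E by blast

lemma full_extension_unique:
  assumes Y: "full_extension scale P V tr E Y" and FG: "F \<in> P" "G \<in> P" and \<phi>: "\<phi> \<in> V G"
  shows "Y F G \<phi> = full_E F G \<phi>"
proof -
  have lin: "linear_map_on scale (V G) (V F) (Y F G)"
    using Y FG unfolding full_extension_def by blast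
  have YE: "Y F G (E G K \<psi>) = E F K \<psi>" if "K \<in> P" "K \<le> G" "\<psi> \<in> V0 K" for K \<psi>
    using Y FG that unfolding full_extension_def by blast
  have "Y F G \<phi> = Y F G (\<Sum>K\<in>{K\<in>P. K \<le> G}. E G K (bubble K (tr G K \<phi>)))"
    using FG \<phi> by (simp add: decomposition)
  also have "\<dots> = (\<Sum>K\<in>{K\<in>P. K \<le> G}. Y F G (E G K (bubble K (tr G K \<phi>))))"
    using FG \<phi> linear_map_onD(1)[OF linear_E bubble_tr]
    by (intro linear_map_on_sum[OF subspace_V lin]) auto
  also have "\<dots> = full_E F G \<phi>"
    unfolding full_E_def using FG \<phi> by (intro sum.cong refl YE bubble_tr) auto
  finally show ?thesis .
qed

lemma full_E_vanishing:
  assumes "F \<in> P" "G \<in> P" "\<psi> \<in> V0 G"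
  shows "full_E F G \<psi> = E F G \<psi>"
  using full_E_E[of F G G \<psi>] assms by (simp add: E_incl)

lemma tr_full_E:
  assumes "F \<in> P" "G \<in> P" "T \<in> P" "G \<le> T" "\<phi> \<in> V F"
  shows "tr T G (full_E T F \<phi>) = full_E G F \<phi>"
proof -
  have "tr T G (full_E T F \<phi>)
      = (\<Sum>L\<in>{L\<in>P. L \<le> F}. tr T G (E T L (bubble L (tr F L \<phi>))))"
    unfolding full_E_def using assms linear_map_onD(1)[OF linear_E bubble_tr]
    by (intro linear_map_on_sum[OF subspace_V linear_tr]) auto
  also have "\<dots> = full_E G F \<phi>"
    unfolding full_E_def using assms by (intro sum.cong refl tr_E bubble_tr) auto
  finally show ?thesis .
qed

lemma full_E_same:
  assumes "G \<in> P" "\<phi> \<in> V G"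
  shows "full_E G G \<phi> = \<phi>"
  unfolding full_E_def using assms by (rule decomposition)

text \<open>
  The expansion of \<open>full_E G F \<phi>\<close> runs over all \<open>L \<le> F\<close>, but \<open>E G L\<close> vanishes unless \<open>L \<le> G\<close>,
  that is, unless \<open>L \<le> K\<close>.
\<close>

lemma full_E_meet:
  assumes "F \<in> P" "G \<in> P" "is_meet P F G K" "\<phi> \<in> V F"
  shows "full_E G F \<phi> = full_E G K (tr F K \<phi>)"
proof -
  have K: "K \<in> P" "K \<le> F" "K \<le> G" and meet: "\<And>L. L \<in> P \<Longrightarrow> L \<le> F \<Longrightarrow> L \<le> G \<Longrightarrow> L \<le> K"
    using assms(3) unfolding is_meet_def by auto
  have "full_E G F \<phi> = (\<Sum>L\<in>{L\<in>P. L \<le> K}. E G L (bubble L (tr F L \<phi>)))"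
    unfolding full_E_def
  proof (rule sum.mono_neutral_right)
    show "{L\<in>P. L \<le> K} \<subseteq> {L\<in>P. L \<le> F}"
      using K by auto
    show "\<forall>L\<in>{L\<in>P. L \<le> F} - {L\<in>P. L \<le> K}. E G L (bubble L (tr F L \<phi>)) = 0"
      using assms meet by (auto intro!: E_zero bubble_tr)
  qed (simp add: finite_P)
  also have "\<dots> = full_E G K (tr F K \<phi>)"
    unfolding full_E_def using assms K by (intro sum.cong refl) (simp add: tr_comp)
  finally show ?thesis .
qed

end

theorem corollary2p16:
  fixes scale :: "'k::field \<Rightarrow> 'v::ab_group_add \<Rightarrow> 'v"
    and P :: "'p::order set"
    and V :: "'p \<Rightarrow> 'v set"
    and tr E :: "'p \<Rightarrow> 'p \<Rightarrow> 'v \<Rightarrow> 'v"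
  assumes "finite P"
    and "function_space scale P V tr"
    and "consistent_extension_operators scale P V tr E"
  shows "\<exists>X. full_extension scale P V tr E X \<and>
    (\<forall>Y. full_extension scale P V tr E Y \<longrightarrow>
       (\<forall>F\<in>P. \<forall>G\<in>P. \<forall>\<phi>\<in>V G. Y F G \<phi> = X F G \<phi>)) \<and>
    (\<forall>F\<in>P. \<forall>G\<in>P. \<forall>\<psi>\<in>vanishing_trace P V tr G. X F G \<psi> = E F G \<psi>) \<and>
    (\<forall>F\<in>P. \<forall>G\<in>P. G \<le> F \<longrightarrow> (\<forall>\<phi>\<in>V G. tr F G (X F G \<phi>) = \<phi>)) \<and>
    (\<forall>K\<in>P. \<forall>F\<in>P. \<forall>G\<in>P. \<forall>T\<in>P.
       K \<le> F \<longrightarrow> K \<le> G \<longrightarrow> F \<le> T \<longrightarrow> G \<le> T \<longrightarrow> is_meet P F G K \<longrightarrow>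
         (\<forall>\<phi>\<in>V F. tr T G (X T F \<phi>) = X G K (tr F K \<phi>)))"
proof -
  interpret finite_consistent_extension_operators scale P V tr E
    using assms(1,3)
    by (intro finite_consistent_extension_operators.intro
        finite_consistent_extension_operators_axioms.intro)
  show ?thesis
  proof (intro exI[of _ full_E] conjI ballI allI impI)
    show "full_extension scale P V tr E full_E"
      by (rule full_extension_full_E)
  next
    fix Y F G \<phi>
    assume "full_extension scale P V tr E Y" "F \<in> P" "G \<in> P" "\<phi> \<in> V G"
    then show "Y F G \<phi> = full_E F G \<phi>"
      by (rule full_extension_unique)
  next
    fix F G \<psi>
    assume "F \<in> P" "G \<in> P" "\<psi> \<in> vanishing_trace P V tr G"
    then show "full_E F G \<psi> = E F G \<psi>"
      by (rule full_E_vanishing)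
  next
    fix F G \<phi>
    assume "F \<in> P" "G \<in> P" "G \<le> F" "\<phi> \<in> V G"
    then show "tr F G (full_E F G \<phi>) = \<phi>"
      by (simp add: tr_full_E full_E_same)
  next
    fix K F G T \<phi>
    assume "F \<in> P" "G \<in> P" "T \<in> P" "G \<le> T" "is_meet P F G K" "\<phi> \<in> V F"
    then show "tr T G (full_E T F \<phi>) = full_E G K (tr F K \<phi>)"
      by (simp add: tr_full_E full_E_meet)
  qed
qed

end
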